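(* Let $h>0$, $k,w\in C^2[0,h]$ with $k>0$ on $[0,h]$ and $w(0)=w(h)=0$. Let $0<t_1<\dots<t_N$ and $r_1,\dots,r_N>0$. Let $\rho\in C^1[0,h]$ be nonnegative and increasing (respectively, decreasing) with respect to $z$. Then for each $1\le i\le N$ the function $G_i\in L^2(0,t_N)$ defined in the context is decreasing (respectively, increasing) with respect to $t$.
   Context: Let $L^*p=(kp')'+wp'$, where $'=d/dz$. The Sturm–Liouville problem $L^*p+\lambda p=0$, $p'(0)=p'(h)=0$ has a sequence of simple eigenvalues $0=\lambda_0<\lambda_1<\cdots$ with corresponding eigenfunctions $\rho_n$ forming a basis of $L^2(0,h)$, normalized so that $\rho_n(0)=1$ for each $n$. Write $\rho=\sum_{n=0}^\infty a_n\rho_n$ in $L^2(0,h)$ and define $$G_i(t)=k(0)\,r_i^{-1}\left(\sum_{n=0}^\infty a_n e^{\lambda_n(t-t_i)}\right)\chi_{[0,t_i]}(t),\qquad 1\le i\le N,$$ where $\chi_{[0,t_i]}$ is the characteristic function of $[0,t_i]$. These functions belong to $L^2(0,t_N)$.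
   Formalization: For decreasing ρ, G_i is proved increasing on [0,t_i] rather than on all of (0,t_N): for i<N and nonzero ρ, G_i is positive at t_i and vanishes afterwards, so the claim on (0,t_N) is false. Increasing and decreasing are meant in the weak sense. *)

theory Defs
  imports "HOL-Analysis.Analysis"
begin

text \<open>Derivatives on the closed interval \<open>[0,h]\<close> are one-sided at the end points.\<close>

definition C1_on :: "real set \<Rightarrow> (real \<Rightarrow> real) \<Rightarrow> bool" where
  "C1_on S f \<longleftrightarrow>
     (\<exists>f'. (\<forall>x\<in>S. (f has_real_derivative f' x) (at x within S)) \<and> continuous_on S f')"

definition C2_on :: "real set \<Rightarrow> (real \<Rightarrow> real) \<Rightarrow> bool" where
  "C2_on S f \<longleftrightarrow>
     (\<exists>f'. (\<forall>x\<in>S. (f has_real_derivative f' x) (at x within S)) \<and> C1_on S f')"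

definition D_on :: "real \<Rightarrow> (real \<Rightarrow> real) \<Rightarrow> real \<Rightarrow> real" where
  "D_on h f z = vector_derivative f (at z within {0..h})"

definition Lstar ::
  "(real \<Rightarrow> real) \<Rightarrow> (real \<Rightarrow> real) \<Rightarrow> real \<Rightarrow> (real \<Rightarrow> real) \<Rightarrow> real \<Rightarrow> real" where
  "Lstar k w h p z = D_on h (\<lambda>y. k y * D_on h p y) z + w z * D_on h p z"

definition SL_eigenfunction ::
  "(real \<Rightarrow> real) \<Rightarrow> (real \<Rightarrow> real) \<Rightarrow> real \<Rightarrow> real \<Rightarrow> (real \<Rightarrow> real) \<Rightarrow> bool" where
  "SL_eigenfunction k w h \<mu> p \<longleftrightarrow>
     C2_on {0..h} p \<and>
     (\<exists>z\<in>{0..h}. p z \<noteq> 0) \<and>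
     (\<forall>z\<in>{0..h}. Lstar k w h p z + \<mu> * p z = 0) \<and>
     D_on h p 0 = 0 \<and> D_on h p h = 0"

definition SL_eigenvalue ::
  "(real \<Rightarrow> real) \<Rightarrow> (real \<Rightarrow> real) \<Rightarrow> real \<Rightarrow> real \<Rightarrow> bool" where
  "SL_eigenvalue k w h \<mu> \<longleftrightarrow> (\<exists>p. SL_eigenfunction k w h \<mu> p)"

definition SL_simple ::
  "(real \<Rightarrow> real) \<Rightarrow> (real \<Rightarrow> real) \<Rightarrow> real \<Rightarrow> real \<Rightarrow> bool" where
  "SL_simple k w h \<mu> \<longleftrightarrow>
     (\<forall>p q. SL_eigenfunction k w h \<mu> p \<and> SL_eigenfunction k w h \<mu> q
        \<longrightarrow> (\<exists>c. \<forall>z\<in>{0..h}. q z = c * p z))"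

text \<open>Membership of a pointwise given function in \<open>L\<^sup>2(0,b)\<close>; measurability is not
  implied by integrability of the square.\<close>

definition L2_on :: "real \<Rightarrow> (real \<Rightarrow> real) \<Rightarrow> bool" where
  "L2_on b f \<longleftrightarrow>
     set_borel_measurable lebesgue {0<..<b} f \<and>
     set_integrable lebesgue {0<..<b} (\<lambda>z. (f z)\<^sup>2)"

text \<open>\<open>f = (\<Sum>n. c n * \<phi> n)\<close> with convergence in \<open>L\<^sup>2(0,b)\<close>. It is only used for \<open>f\<close> and
  \<open>\<phi> n\<close> in \<open>L\<^sup>2(0,b)\<close>, so that the integrals below are genuine.\<close>

definition L2_expansion ::
  "real \<Rightarrow> (nat \<Rightarrow> real \<Rightarrow> real) \<Rightarrow> (real \<Rightarrow> real) \<Rightarrow> (nat \<Rightarrow> real) \<Rightarrow> bool" where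
  "L2_expansion b \<phi> f c \<longleftrightarrow>
     (\<lambda>m. set_lebesgue_integral lebesgue {0<..<b} (\<lambda>z. (f z - (\<Sum>n<m. c n * \<phi> n z))\<^sup>2))
       \<longlonglongrightarrow> 0"

definition L2_basis :: "real \<Rightarrow> (nat \<Rightarrow> real \<Rightarrow> real) \<Rightarrow> bool" where
  "L2_basis b \<phi> \<longleftrightarrow>
     (\<forall>n. L2_on b (\<phi> n)) \<and> (\<forall>f. L2_on b f \<longrightarrow> (\<exists>!c. L2_expansion b \<phi> f c))"

text \<open>The value \<open>k(0)\<close> is passed as \<open>k0\<close>. For \<open>s > T\<close> the series may diverge; the indicator
  then makes the function vanish.\<close>

definition G_fun ::
  "real \<Rightarrow> real \<Rightarrow> real \<Rightarrow> (nat \<Rightarrow> real) \<Rightarrow> (nat \<Rightarrow> real) \<Rightarrow> real \<Rightarrow> real" where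
  "G_fun k0 r T a ev s =
     k0 * inverse r * (\<Sum>n. a n * exp (ev n * (s - T))) * indicator {0..T} s"

end

theory Submission
  imports Defs "HOL-Real_Asymp.Real_Asymp"
begin

text \<open>
  Let \<open>\<sigma> = exp (\<integral> w/k)\<close> and \<open>P = \<sigma> k\<close>, so that \<open>\<sigma> L\<^sup>* p = (P p')'\<close> and the
  eigenfunctions are orthogonal both in \<open>L\<^sup>2(\<sigma>)\<close> and for the energy \<open>\<integral> P f' g' + \<sigma> f g\<close>. Bessel's inequality
  for the energy and a one-dimensional Sobolev inequality show that the expansion of a \<open>C\<^sup>1\<close> function \<open>f\<close>
  converges uniformly, with \<open>\<Sum> \<bar>a\<^sub>n\<bar> < \<infinity>\<close> and \<open>\<Sum> a\<^sub>n = f(0)\<close>.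

  Up to a positive factor \<open>G\<^sub>i(t)\<close> is \<open>u(0, t\<^sub>i - t)\<close>, where \<open>u\<close> solves \<open>u\<^sub>\<tau> = L\<^sup>* u\<close> with Neumann
  conditions and \<open>u(\<cdot>, 0) = \<rho>\<close>. We replace the evolution by implicit Euler steps \<open>u - \<epsilon> L\<^sup>* u = f\<close>, which multiply
  the \<open>n\<close>th coefficient by \<open>1 / (1 + \<epsilon> \<lambda>\<^sub>n)\<close>. If \<open>f\<close> is increasing, a minimum principle for the
  flux \<open>W = P u'\<close>, which vanishes at both ends, gives \<open>W \<ge> 0\<close>: then \<open>u\<close> is again increasing, and \<open>W'(0) \<ge> 0\<close>
  means \<open>u(0) \<ge> f(0)\<close>. Hence \<open>\<Sum> a\<^sub>n (1 + \<epsilon> \<lambda>\<^sub>n)\<^sup>-\<^sup>m\<close> increases with \<open>m\<close>, and \<open>\<epsilon> \<rightarrow> 0\<close> with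
  \<open>m = \<lfloor>\<tau> / \<epsilon>\<rfloor>\<close> gives the monotonicity of \<open>\<Sum> a\<^sub>n exp (- \<lambda>\<^sub>n \<tau>)\<close> in \<open>\<tau>\<close>.
\<close>

subsection \<open>Calculus on a compact interval\<close>

text \<open>The mean value theorem on \<open>{x..y}\<close> only asks for derivatives within
  \<open>{x..y}\<close>, so one-sided derivatives at \<open>a\<close> and \<open>b\<close> need no
  separate treatment.\<close>

lemma mvt_within_Icc:
  fixes f f' :: "real \<Rightarrow> real"
  assumes der: "\<And>x. x \<in> {a..b} \<Longrightarrow> (f has_real_derivative f' x) (at x within {a..b})"
    and "a \<le> x" "x < y" "y \<le> b"
  obtains z where "x < z" "z < y" "f y - f x = f' z * (y - x)"
proof -
  have "\<exists>z\<in>{x<..<y}. f y - f x = f' z * (y - x)"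
  proof (rule mvt_simple[OF \<open>x < y\<close>])
    fix z assume "x \<le> z" "z \<le> y"
    then have "z \<in> {a..b}" "{x..y} \<subseteq> {a..b}" using assms by auto
    then show "(f has_derivative (*) (f' z)) (at z within {x..y})"
      using der[of z] unfolding has_field_derivative_def
      by (blast intro: has_derivative_subset)
  qed
  then show thesis using that by auto
qed

lemma mono_on_Icc_deriv_nonneg:
  fixes f f' :: "real \<Rightarrow> real"
  assumes der: "\<And>x. x \<in> {a..b} \<Longrightarrow> (f has_real_derivative f' x) (at x within {a..b})"
    and nonneg: "\<And>x. x \<in> {a..b} \<Longrightarrow> 0 \<le> f' x"
  shows "mono_on {a..b} f"
proof (rule mono_onI)
  fix x y assume xy: "x \<in> {a..b}" "y \<in> {a..b}" "x \<le> y"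
  show "f x \<le> f y"
  proof (cases "x = y")
    case False
    obtain z where z: "x < z" "z < y" "f y - f x = f' z * (y - x)"
      using mvt_within_Icc[OF der, where x = x and y = y] xy False by auto
    then have "0 \<le> f' z * (y - x)" using nonneg[of z] xy by simp
    then show ?thesis using z by linarith
  qed simp
qed

text \<open>Termwise differentiation, started from convergence at the single point 0. The mean value
  theorem for \<open>F n - g\<close> bounds its growth from 0 by \<open>h\<close> times the uniform
  error of the derivatives, which makes the convergence of \<open>F\<close> uniform too. The
  resolvent construction uses this twice: for the flux and then for the solution.\<close>

lemma uniform_limit_antiderivative:
  fixes F F' :: "nat \<Rightarrow> real \<Rightarrow> real"
  assumes "0 < h"
    and der: "\<And>M x. x \<in> {0..h} \<Longrightarrow> (F M has_real_derivative F' M x) (at x within {0..h})"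
    and unif: "uniform_limit {0..h} F' g' sequentially"
    and init: "(\<lambda>M. F M 0) \<longlonglongrightarrow> l"
  obtains g where "uniform_limit {0..h} F g sequentially" "g 0 = l"
    "\<And>x. x \<in> {0..h} \<Longrightarrow> (g has_real_derivative g' x) (at x within {0..h})"
proof -
  have "\<exists>g. \<forall>x\<in>{0..h}. (\<lambda>n. F n x) \<longlonglongrightarrow> g x \<and> (g has_derivative (*) (g' x)) (at x within {0..h})"
  proof (rule has_derivative_sequence[of _ F "\<lambda>M x. (*) (F' M x)"])
    fix e :: real assume e: "e > 0"
    from unif e have "\<forall>\<^sub>F n in sequentially. \<forall>x\<in>{0..h}. dist (F' n x) (g' x) < e"
      by (rule uniform_limitD)
    then show "\<forall>\<^sub>F n in sequentially. \<forall>x\<in>{0..h}. \<forall>d. norm (F' n x * d - g' x * d) \<le> e * norm d"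
    proof eventually_elim
      case (elim n)
      show ?case
      proof (intro ballI allI)
        fix x d assume "x \<in> {0..h}"
        then have "\<bar>F' n x - g' x\<bar> \<le> e" using elim by (auto simp: dist_real_def less_imp_le)
        then have "\<bar>F' n x - g' x\<bar> * \<bar>d\<bar> \<le> e * \<bar>d\<bar>" by (rule mult_right_mono) simp
        then show "norm (F' n x * d - g' x * d) \<le> e * norm d"
          by (simp add: abs_mult[symmetric] left_diff_distrib)
      qed
    qed
  qed (use assms in \<open>auto simp: has_field_derivative_def\<close>)
  then obtain g where "\<forall>x\<in>{0..h}. (\<lambda>n. F n x) \<longlonglongrightarrow> g x \<and> (g has_derivative (*) (g' x)) (at x within {0..h})"
    by blast
  then have lim: "\<And>x. x \<in> {0..h} \<Longrightarrow> (\<lambda>n. F n x) \<longlonglongrightarrow> g x"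
    and gder: "\<And>x. x \<in> {0..h} \<Longrightarrow> (g has_real_derivative g' x) (at x within {0..h})"
    by (simp_all add: has_field_derivative_def)
  have g0: "g 0 = l" using lim[of 0] init \<open>0 < h\<close> by (auto intro: LIMSEQ_unique)
  have "uniform_limit {0..h} F g sequentially"
  proof (rule uniform_limitI)
    fix e :: real assume e: "e > 0"
    \<comment> \<open>Chosen so that the error \<open>d\<close> at 0 and the growth
      \<open>d * h\<close> add up to \<open>e / 2\<close>.\<close>
    define d where "d = e / (2 * (1 + h))"
    have d: "d > 0" using e \<open>0 < h\<close> by (simp add: d_def)
    have "d + d * h = d * (1 + h)" by (simp add: algebra_simps)
    also have "\<dots> = e / 2" using \<open>0 < h\<close> unfolding d_def by (simp add: divide_simps)
    also have "\<dots> < e" using e by simp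
    finally have de: "d + d * h < e" .
    have "\<forall>\<^sub>F n in sequentially. \<forall>x\<in>{0..h}. dist (F' n x) (g' x) < d"
      by (rule uniform_limitD[OF unif d])
    moreover have "\<forall>\<^sub>F n in sequentially. dist (F n 0) (g 0) < d"
      using init g0 d by (simp add: tendsto_iff)
    ultimately show "\<forall>\<^sub>F n in sequentially. \<forall>x\<in>{0..h}. dist (F n x) (g x) < e"
    proof eventually_elim
      case (elim n)
      show ?case
      proof
        fix x assume x: "x \<in> {0..h}"
        have bd: "\<bar>F n 0 - g 0\<bar> < d" using elim by (simp add: dist_real_def)
        show "dist (F n x) (g x) < e"
        proof (cases "x = 0")
          case True
          have "0 \<le> d * h" using d \<open>0 < h\<close> by simp
          then show ?thesis using bd de True by (simp add: dist_real_def)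
        next
          case False
          have der': "((\<lambda>x. F n x - g x) has_real_derivative F' n x - g' x) (at x within {0..h})"
            if "x \<in> {0..h}" for x using der gder that by (intro derivative_intros) auto
          obtain z where z: "0 < z" "z < x"
            "(F n x - g x) - (F n 0 - g 0) = (F' n z - g' z) * (x - 0)"
            using mvt_within_Icc[OF der', where x = 0 and y = x] x False by auto
          have "\<bar>F' n z - g' z\<bar> \<le> d" using elim z x by (auto simp: dist_real_def less_imp_le)
          then have "\<bar>(F' n z - g' z) * (x - 0)\<bar> \<le> d * h"
            unfolding abs_mult using x d by (intro mult_mono) auto
          then show ?thesis using z(3) bd de unfolding dist_real_def by linarith
        qed
      qed
    qed
  qed
  then show thesis using that g0 gder by blast
qed

lemma tendsto_integral_uniform_limit:
  fixes f :: "nat \<Rightarrow> real \<Rightarrow> real"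
  assumes u: "uniform_limit {a..b} f g sequentially"
    and c: "\<And>n. continuous_on {a..b} (f n)"
  shows "(\<lambda>n. integral {a..b} (f n)) \<longlonglongrightarrow> integral {a..b} g"
proof -
  obtain I J where "\<And>n. (f n has_integral I n) {a..b}" "(g has_integral J) {a..b}" "I \<longlonglongrightarrow> J"
    using uniform_limit_integral[OF u c] by auto
  moreover from this have "(\<lambda>n. integral {a..b} (f n)) = I" "integral {a..b} g = J"
    by (auto simp: integral_unique)
  ultimately show ?thesis by simp
qed

text \<open>Translates the Lebesgue integrals in \<open>L2_expansion\<close> into gauge integrals
  over the closed interval, where the calculus of the proof takes place.\<close>

lemma set_lebesgue_integral_open_eq_integral:
  fixes f :: "real \<Rightarrow> real"
  assumes "continuous_on {a..b} f"
  shows "set_lebesgue_integral lebesgue {a<..<b} f = integral {a..b} f"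
proof -
  have "f absolutely_integrable_on {a..b}" using assms by (rule absolutely_integrable_continuous_real)
  then have "f absolutely_integrable_on {a<..<b}" 
    by (rule set_integrable_subset) auto
  then have "set_lebesgue_integral lebesgue {a<..<b} f = integral {a<..<b} f"
    by (rule set_lebesgue_integral_eq_integral)
  also have "\<dots> = integral {a..b} f" by (simp add: integral_open_interval_real)
  finally show ?thesis .
qed

text \<open>The minimizing parameter is \<open>s = B / C\<close>. If \<open>C = 0\<close> the
  expression is affine in \<open>s\<close>, and a nonzero \<open>B\<close> would let
  \<open>s = (A + 1) / (2 * B)\<close> produce the value -1.\<close>

lemma Cauchy_Schwarz_quadratic:
  fixes A B C :: real
  assumes "0 \<le> C" and quad: "\<And>s. 0 \<le> A - 2 * s * B + s\<^sup>2 * C"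
  shows "B\<^sup>2 \<le> A * C"
proof (cases "C = 0")
  case True
  have "B = 0"
  proof (rule ccontr)
    assume "B \<noteq> 0"
    then show False using quad[of "(A + 1) / (2 * B)"] True by simp
  qed
  then show ?thesis using True by simp
next
  case False
  then have "C > 0" using assms(1) by simp
  have "0 \<le> A - B\<^sup>2 / C"
    using quad[of "B / C"] \<open>C > 0\<close> by (simp add: field_simps power2_eq_square)
  then show ?thesis using \<open>C > 0\<close> by (simp add: field_simps)
qed

lemma Cauchy_Schwarz_integral_continuous:
  fixes f g :: "real \<Rightarrow> real"
  assumes f: "continuous_on {a..b} f" and g: "continuous_on {a..b} g"
  shows "(integral {a..b} (\<lambda>x. f x * g x))\<^sup>2 \<le>
    integral {a..b} (\<lambda>x. (f x)\<^sup>2) * integral {a..b} (\<lambda>x. (g x)\<^sup>2)"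
proof (rule Cauchy_Schwarz_quadratic)
  have i: "(\<lambda>x. (f x)\<^sup>2) integrable_on {a..b}" "(\<lambda>x. (g x)\<^sup>2) integrable_on {a..b}"
    "(\<lambda>x. f x * g x) integrable_on {a..b}"
    by (intro integrable_continuous_real continuous_intros f g)+
  show "0 \<le> integral {a..b} (\<lambda>x. (g x)\<^sup>2)" by (rule integral_nonneg[OF i(2)]) simp
  fix s :: real
  have "((\<lambda>x. (f x)\<^sup>2 - 2 * s * (f x * g x) + s\<^sup>2 * (g x)\<^sup>2) has_integral
     integral {a..b} (\<lambda>x. (f x)\<^sup>2) - 2 * s * integral {a..b} (\<lambda>x. f x * g x)
       + s\<^sup>2 * integral {a..b} (\<lambda>x. (g x)\<^sup>2)) {a..b}"
    by (intro has_integral_add has_integral_diff has_integral_mult_right integrable_integral i)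
  moreover have "0 \<le> (f x)\<^sup>2 - 2 * s * (f x * g x) + s\<^sup>2 * (g x)\<^sup>2" for x
    using zero_le_power2[of "f x - s * g x"] by (simp add: power2_eq_square algebra_simps)
  ultimately show "0 \<le> integral {a..b} (\<lambda>x. (f x)\<^sup>2) - 2 * s * integral {a..b} (\<lambda>x. f x * g x)
       + s\<^sup>2 * integral {a..b} (\<lambda>x. (g x)\<^sup>2)"
    by (rule has_integral_nonneg)
qed

text \<open>The decay factor of implicit Euler with step \<open>1 / Suc j\<close> run up to time
  \<open>\<tau>\<close>. Its logarithm is minus the product of
  \<open>\<lfloor>n \<tau>\<rfloor> / n\<close>, which tends to \<open>\<tau>\<close>, and
  \<open>n * ln (1 + x / n)\<close>, which tends to \<open>x\<close>, where
  \<open>n = Suc j\<close>.\<close>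

lemma tendsto_inverse_power_floor_exp:
  fixes x \<tau> :: real
  assumes "0 \<le> x" "0 \<le> \<tau>"
  shows "(\<lambda>j. 1 / (1 + 1 / real (Suc j) * x) ^ nat \<lfloor>real (Suc j) * \<tau>\<rfloor>) \<longlonglongrightarrow> exp (- x * \<tau>)"
proof -
  have 1: "(\<lambda>j. real (Suc j) * ln (1 + x / real (Suc j))) \<longlonglongrightarrow> x"
  proof (cases "x = 0")
    case False
    then have "x > 0" using assms by simp
    then show ?thesis by real_asymp
  qed simp
  have 2: "(\<lambda>j. real_of_int \<lfloor>real (Suc j) * \<tau>\<rfloor> / real (Suc j)) \<longlonglongrightarrow> \<tau>"
  proof (rule tendsto_sandwich)
    show "(\<lambda>j. \<tau> - 1 / real (Suc j)) \<longlonglongrightarrow> \<tau>" by real_asymp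
    show "\<forall>\<^sub>F j in sequentially. \<tau> - 1 / real (Suc j) \<le> real_of_int \<lfloor>real (Suc j) * \<tau>\<rfloor> / real (Suc j)"
    proof (rule always_eventually, rule allI)
      fix j
      have "real (Suc j) * \<tau> - 1 \<le> real_of_int \<lfloor>real (Suc j) * \<tau>\<rfloor>" by linarith
      then have "(real (Suc j) * \<tau> - 1) / real (Suc j) \<le> real_of_int \<lfloor>real (Suc j) * \<tau>\<rfloor> / real (Suc j)"
        by (rule divide_right_mono) simp
      then show "\<tau> - 1 / real (Suc j) \<le> real_of_int \<lfloor>real (Suc j) * \<tau>\<rfloor> / real (Suc j)"
        by (simp add: diff_divide_distrib del: of_nat_Suc)
    qed
    show "\<forall>\<^sub>F j in sequentially. real_of_int \<lfloor>real (Suc j) * \<tau>\<rfloor> / real (Suc j) \<le> \<tau>"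
    proof (rule always_eventually, rule allI)
      fix j
      have "real_of_int \<lfloor>real (Suc j) * \<tau>\<rfloor> \<le> real (Suc j) * \<tau>" by linarith
      then show "real_of_int \<lfloor>real (Suc j) * \<tau>\<rfloor> / real (Suc j) \<le> \<tau>"
        by (simp add: field_simps del: of_nat_Suc)
    qed
  qed simp
  have "(\<lambda>j. exp (- (real_of_int \<lfloor>real (Suc j) * \<tau>\<rfloor> / real (Suc j) * (real (Suc j) * ln (1 + x / real (Suc j))))))
     \<longlonglongrightarrow> exp (- (\<tau> * x))"
    by (intro tendsto_intros 1 2)
  moreover have "exp (- (real_of_int \<lfloor>real (Suc j) * \<tau>\<rfloor> / real (Suc j) * (real (Suc j) * ln (1 + x / real (Suc j)))))
    = 1 / (1 + 1 / real (Suc j) * x) ^ nat \<lfloor>real (Suc j) * \<tau>\<rfloor>" for j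
  proof -
    have pos: "1 + x / real (Suc j) > 0" using assms by (simp add: add_pos_nonneg)
    have "real_of_int \<lfloor>real (Suc j) * \<tau>\<rfloor> = real (nat \<lfloor>real (Suc j) * \<tau>\<rfloor>)"
      using assms by simp
    then have "exp (- (real_of_int \<lfloor>real (Suc j) * \<tau>\<rfloor> / real (Suc j) * (real (Suc j) * ln (1 + x / real (Suc j)))))
      = exp (- (real (nat \<lfloor>real (Suc j) * \<tau>\<rfloor>) * ln (1 + x / real (Suc j))))"
      by (simp del: of_nat_Suc)
    also have "\<dots> = 1 / (1 + x / real (Suc j)) ^ nat \<lfloor>real (Suc j) * \<tau>\<rfloor>"
      using pos by (simp add: exp_minus exp_of_nat_mult divide_inverse del: of_nat_Suc)
    finally show ?thesis by simp
  qed
  ultimately show ?thesis by (simp add: mult.commute)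
qed

subsection \<open>Eigenfunction expansions\<close>

text \<open>The eigenvalue problem in self-adjoint form: \<open>q n\<close> is the derivative of
  \<open>\<phi> n\<close>, and \<open>P * q n\<close> is its flux. The function to be expanded
  enters the individual lemmas through \<open>L2_expansion\<close>.\<close>

locale sl_system =
  fixes h :: real and \<sigma> P :: "real \<Rightarrow> real" and ev :: "nat \<Rightarrow> real"
    and \<phi> q :: "nat \<Rightarrow> real \<Rightarrow> real"
  assumes h_pos: "0 < h"
    and cont_\<sigma>: "continuous_on {0..h} \<sigma>" and cont_P: "continuous_on {0..h} P"
    and \<sigma>_pos: "\<And>z. z \<in> {0..h} \<Longrightarrow> 0 < \<sigma> z" and P_pos: "\<And>z. z \<in> {0..h} \<Longrightarrow> 0 < P z"
    and deriv_\<phi>: "\<And>n z. z \<in> {0..h} \<Longrightarrow> (\<phi> n has_real_derivative q n z) (at z within {0..h})"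
    and cont_q: "\<And>n. continuous_on {0..h} (q n)"
    and deriv_flux: "\<And>n z. z \<in> {0..h} \<Longrightarrow>
      ((\<lambda>z. P z * q n z) has_real_derivative - ev n * (\<sigma> z * \<phi> n z)) (at z within {0..h})"
    and q_0: "\<And>n. q n 0 = 0" and q_h: "\<And>n. q n h = 0"
    and ev_nonneg: "\<And>n. 0 \<le> ev n" and inj_ev: "inj ev"
    and \<phi>_0: "\<And>n. \<phi> n 0 = 1"
begin

definition ip :: "(real \<Rightarrow> real) \<Rightarrow> (real \<Rightarrow> real) \<Rightarrow> real" where
  "ip f g = integral {0..h} (\<lambda>z. \<sigma> z * f z * g z)"

abbreviation sqn :: "nat \<Rightarrow> real" where "sqn n \<equiv> ip (\<phi> n) (\<phi> n)"

text \<open>A weighted Sobolev inner product, the form belonging to the identity minus the operator.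
  The derivatives are separate arguments, tied to the functions by \<open>C1_pair\<close>.\<close>

definition energy where
  "energy f f' g g' = integral {0..h} (\<lambda>z. P z * f' z * g' z + \<sigma> z * f z * g z)"

definition C1_pair where
  "C1_pair f f' \<longleftrightarrow> continuous_on {0..h} f' \<and>
     (\<forall>z\<in>{0..h}. (f has_real_derivative f' z) (at z within {0..h}))"

definition psum :: "(nat \<Rightarrow> real) \<Rightarrow> nat set \<Rightarrow> real \<Rightarrow> real" where
  "psum c A z = (\<Sum>n\<in>A. c n * \<phi> n z)"

definition dpsum :: "(nat \<Rightarrow> real) \<Rightarrow> nat set \<Rightarrow> real \<Rightarrow> real" where
  "dpsum c A z = (\<Sum>n\<in>A. c n * q n z)"

lemma C1_pairD:
  assumes "C1_pair f f'"
  shows "continuous_on {0..h} f" "continuous_on {0..h} f'"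
    "\<And>z. z \<in> {0..h} \<Longrightarrow> (f has_real_derivative f' z) (at z within {0..h})"
  using assms unfolding C1_pair_def by (auto intro: DERIV_continuous_on)

lemma C1_pair_\<phi>: "C1_pair (\<phi> n) (q n)"
  unfolding C1_pair_def using cont_q deriv_\<phi> by auto

lemma C1_pair_psum: "C1_pair (psum c A) (dpsum c A)"
  unfolding C1_pair_def psum_def[abs_def] dpsum_def[abs_def]
  by (intro conjI ballI continuous_on_sum continuous_on_mult_left cont_q DERIV_sum DERIV_cmult deriv_\<phi>)

lemma C1_pair_diff: "C1_pair f f' \<Longrightarrow> C1_pair g g' \<Longrightarrow> C1_pair (\<lambda>z. f z - g z) (\<lambda>z. f' z - g' z)"
  unfolding C1_pair_def by (simp add: continuous_on_diff DERIV_diff)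

section \<open>Orthogonality and Bessel's inequality for the energy\<close>

lemma ip_commute: "ip f g = ip g f"
  unfolding ip_def by (simp add: mult.commute mult.left_commute)

lemma energy_commute: "energy f f' g g' = energy g g' f f'"
  unfolding energy_def by (simp add: mult.commute mult.left_commute)

lemma energy_integrable:
  assumes "C1_pair f f'" "C1_pair g g'"
  shows "(\<lambda>z. P z * f' z * g' z + \<sigma> z * f z * g z) integrable_on {0..h}"
  by (intro integrable_continuous_real continuous_intros cont_P cont_\<sigma> C1_pairD[OF assms(1)] C1_pairD[OF assms(2)])

lemma energy_diff:
  assumes "C1_pair f f'" "C1_pair g g'"
  shows "energy (\<lambda>z. f z - g z) (\<lambda>z. f' z - g' z) (\<lambda>z. f z - g z) (\<lambda>z. f' z - g' z) =
    energy f f' f f' - 2 * energy g g' f f' + energy g g' g g'"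
proof -
  let ?i = "\<lambda>f f' g g' z. P z * f' z * g' z + \<sigma> z * f z * g z"
  note I = integrable_integral[OF energy_integrable]
  have "((\<lambda>z. ?i f f' f f' z - 2 * ?i g g' f f' z + ?i g g' g g' z) has_integral
     energy f f' f f' - 2 * energy g g' f f' + energy g g' g g') {0..h}"
    unfolding energy_def by (intro has_integral_add has_integral_diff has_integral_mult_right I assms)
  moreover have "?i f f' f f' z - 2 * ?i g g' f f' z + ?i g g' g g' z =
     ?i (\<lambda>z. f z - g z) (\<lambda>z. f' z - g' z) (\<lambda>z. f z - g z) (\<lambda>z. f' z - g' z) z" for z
    by (simp add: algebra_simps)
  ultimately show ?thesis unfolding energy_def by (simp only: integral_unique)
qed

lemma energy_nonneg: "C1_pair f f' \<Longrightarrow> 0 \<le> energy f f' f f'"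
  unfolding energy_def
  by (rule integral_nonneg[OF energy_integrable]) (auto simp: mult.assoc P_pos \<sigma>_pos less_imp_le)

lemma sqn_nonneg: "0 \<le> sqn n"
proof -
  have "(\<lambda>z. \<sigma> z * \<phi> n z * \<phi> n z) integrable_on {0..h}"
    by (intro integrable_continuous_real continuous_intros cont_\<sigma> C1_pairD[OF C1_pair_\<phi>])
  then show ?thesis
    unfolding ip_def by (rule integral_nonneg) (simp add: mult.assoc \<sigma>_pos less_imp_le)
qed

text \<open>Integration by parts of the flux against \<open>g\<close>. The boundary terms vanish
  because \<open>q n\<close> does at both ends, and the flux equation turns the derivative part into
  \<open>ev n\<close> times the weighted inner product.\<close>

lemma energy_\<phi>:
  assumes g: "C1_pair g g'"
  shows "energy (\<phi> n) (q n) g g' = (1 + ev n) * ip (\<phi> n) g"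
proof -
  let ?d = "\<lambda>z. - ev n * (\<sigma> z * \<phi> n z) * g z + P z * q n z * g' z"
  have "(?d has_integral (P h * q n h * g h - P 0 * q n 0 * g 0)) {0..h}"
  proof (rule fundamental_theorem_of_calculus)
    fix z assume z: "z \<in> {0..h}"
    have "((\<lambda>z. P z * q n z * g z) has_real_derivative ?d z) (at z within {0..h})"
      using DERIV_mult'[OF deriv_flux[OF z] C1_pairD(3)[OF g z]] by (simp add: add.commute)
    then show "((\<lambda>z. P z * q n z * g z) has_vector_derivative ?d z) (at z within {0..h})"
      by (simp add: has_real_derivative_iff_has_vector_derivative)
  qed (use h_pos in simp)
  then have 1: "(?d has_integral 0) {0..h}" by (simp add: q_0 q_h)
  have "(\<lambda>z. \<sigma> z * \<phi> n z * g z) integrable_on {0..h}"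
    by (intro integrable_continuous_real continuous_intros cont_\<sigma> C1_pairD[OF C1_pair_\<phi>] C1_pairD[OF g])
  then have "((\<lambda>z. \<sigma> z * \<phi> n z * g z) has_integral ip (\<phi> n) g) {0..h}"
    unfolding ip_def by (rule integrable_integral)
  from has_integral_add[OF 1 has_integral_mult_right[OF this, of "1 + ev n"]]
  show ?thesis
    unfolding energy_def by (intro integral_unique) (simp add: algebra_simps)
qed

text \<open>The energy of \<open>\<phi> m\<close> and \<open>\<phi> n\<close> is symmetric, but
  \<open>energy_\<phi>\<close> evaluates it with the factor \<open>1 + ev m\<close> from one side
  and \<open>1 + ev n\<close> from the other; the eigenvalues are distinct.\<close>

lemma orthogonal: 
  assumes "m \<noteq> n"
  shows "ip (\<phi> m) (\<phi> n) = 0"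
proof -
  have "(1 + ev m) * ip (\<phi> m) (\<phi> n) = (1 + ev n) * ip (\<phi> m) (\<phi> n)"
    using energy_\<phi>[OF C1_pair_\<phi>, of m n] energy_\<phi>[OF C1_pair_\<phi>, of n m]
      energy_commute[of "\<phi> m" "q m" "\<phi> n" "q n"] ip_commute[of "\<phi> m" "\<phi> n"] by metis
  moreover have "ev m \<noteq> ev n" using assms by (simp add: inj_eq[OF inj_ev])
  ultimately show ?thesis by simp
qed

lemma energy_psum:
  assumes A: "finite A" and g: "C1_pair g g'"
  shows "energy (psum c A) (dpsum c A) g g' = (\<Sum>n\<in>A. c n * ((1 + ev n) * ip (\<phi> n) g))"
proof -
  have "energy (psum c A) (dpsum c A) g g' =
     integral {0..h} (\<lambda>z. \<Sum>n\<in>A. c n * (P z * q n z * g' z + \<sigma> z * \<phi> n z * g z))"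
    unfolding energy_def psum_def dpsum_def
    by (rule integral_cong)
      (simp add: sum_distrib_left sum_distrib_right sum.distrib[symmetric] algebra_simps)
  also have "\<dots> = (\<Sum>n\<in>A. c n * energy (\<phi> n) (q n) g g')"
    unfolding energy_def using energy_integrable[OF C1_pair_\<phi> g] A
    by (subst integral_sum) (auto intro: integrable_on_mult_right)
  finally show ?thesis using energy_\<phi>[OF g] by simp
qed

lemma ip_psum:
  assumes A: "finite A"
  shows "ip (\<phi> n) (psum c A) = (if n \<in> A then c n * sqn n else 0)"
proof -
  have int: "(\<lambda>z. \<sigma> z * \<phi> n z * \<phi> m z) integrable_on {0..h}" for m
    by (intro integrable_continuous_real continuous_intros cont_\<sigma> C1_pairD[OF C1_pair_\<phi>])
  have "ip (\<phi> n) (psum c A) = integral {0..h} (\<lambda>z. \<Sum>m\<in>A. c m * (\<sigma> z * \<phi> n z * \<phi> m z))"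
    unfolding ip_def psum_def
    by (rule integral_cong) (simp add: sum_distrib_left algebra_simps)
  also have "\<dots> = (\<Sum>m\<in>A. c m * ip (\<phi> n) (\<phi> m))"
    unfolding ip_def using int A by (subst integral_sum) (auto intro: integrable_on_mult_right)
  also have "\<dots> = (\<Sum>m\<in>A. if m = n then c n * sqn n else 0)"
    using orthogonal by (intro sum.cong) auto
  also have "\<dots> = (if n \<in> A then c n * sqn n else 0)" using A by simp
  finally show ?thesis .
qed

lemma energy_psum_self:
  assumes A: "finite A"
  shows "energy (psum c A) (dpsum c A) (psum c A) (dpsum c A) =
    (\<Sum>n\<in>A. (1 + ev n) * sqn n * (c n)\<^sup>2)"
  unfolding energy_psum[OF A C1_pair_psum] ip_psum[OF A]
  by (intro sum.cong) (auto simp: power2_eq_square)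

text \<open>The energy of \<open>f\<close> minus its partial sum is nonnegative. The mixed energy
  and the energy of the partial sum are the same sum, so twice the former minus the latter leaves
  exactly that sum.\<close>

lemma Bessel:
  assumes f: "C1_pair f f'" and coef: "\<And>n. ip (\<phi> n) f = a n * sqn n" and A: "finite A"
  shows "(\<Sum>n\<in>A. (1 + ev n) * sqn n * (a n)\<^sup>2) \<le> energy f f' f f'"
proof -
  have "0 \<le> energy f f' f f' - 2 * energy (psum a A) (dpsum a A) f f'
      + energy (psum a A) (dpsum a A) (psum a A) (dpsum a A)"
    using energy_nonneg[OF C1_pair_diff[OF f C1_pair_psum]] unfolding energy_diff[OF f C1_pair_psum] .
  also have "energy (psum a A) (dpsum a A) f f' = (\<Sum>n\<in>A. (1 + ev n) * sqn n * (a n)\<^sup>2)"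
    unfolding energy_psum[OF A f] coef by (intro sum.cong) (auto simp: power2_eq_square)
  finally show ?thesis by (simp add: energy_psum_self[OF A])
qed

text \<open>The oscillation of the square of \<open>g\<close> is at most the integral of
  \<open>2 * \<bar>g * g'\<bar>\<close>, hence at most the unweighted energy \<open>J h\<close>.
  Averaging over the comparison point controls the value at \<open>z\<close>, and lower bounds for
  the weights pass to \<open>energy\<close>.\<close>

lemma Sobolev:
  obtains C where "0 \<le> C"
    "\<And>g g' z. C1_pair g g' \<Longrightarrow> z \<in> {0..h} \<Longrightarrow> (g z)\<^sup>2 \<le> C * energy g g' g g'"
proof -
  have ne: "{0..h} \<noteq> {}" using h_pos by simp
  obtain z1 z2 where z12: "z1 \<in> {0..h}" "z2 \<in> {0..h}"
    "\<And>z. z \<in> {0..h} \<Longrightarrow> \<sigma> z1 \<le> \<sigma> z" "\<And>z. z \<in> {0..h} \<Longrightarrow> P z2 \<le> P z"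
    using continuous_attains_inf[OF compact_Icc ne cont_\<sigma>]
      continuous_attains_inf[OF compact_Icc ne cont_P] by blast
  \<comment> \<open>A common positive lower bound of both weights, so that \<open>m * J h\<close> is
    at most the energy.\<close>
  define m where "m = min (\<sigma> z1) (P z2)"
  have m: "m > 0" "\<And>z. z \<in> {0..h} \<Longrightarrow> m \<le> \<sigma> z" "\<And>z. z \<in> {0..h} \<Longrightarrow> m \<le> P z"
    unfolding m_def using z12 \<sigma>_pos P_pos by (auto simp: min_le_iff_disj)
  define C where "C = (1 / h + 1) / m"
  have "(g z)\<^sup>2 \<le> C * energy g g' g g'" if g: "C1_pair g g'" and z: "z \<in> {0..h}" for g g' z
  proof -
    note cg = C1_pairD(1)[OF g] C1_pairD(2)[OF g]
    define J where "J x = integral {0..x} (\<lambda>y. (g y)\<^sup>2 + (g' y)\<^sup>2)" for x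
    have cJ: "continuous_on {0..h} (\<lambda>y. (g y)\<^sup>2 + (g' y)\<^sup>2)" by (intro continuous_intros cg)
    have dJ: "(J has_real_derivative (g x)\<^sup>2 + (g' x)\<^sup>2) (at x within {0..h})" if "x \<in> {0..h}" for x
      unfolding J_def[abs_def] by (rule integral_has_real_derivative[OF cJ that])
    have dg: "((\<lambda>x. (g x)\<^sup>2) has_real_derivative 2 * g x * g' x) (at x within {0..h})" if "x \<in> {0..h}" for x
      using DERIV_power[OF C1_pairD(3)[OF g that], of 2] by (simp add: mult.commute mult.left_commute)
    \<comment> \<open>The two monotone functions \<open>mono1\<close> and \<open>mono2\<close>
      express that the derivative of the squared \<open>g\<close> is bounded in modulus by the
      derivative of \<open>J\<close>; one serves comparison points left of \<open>z\<close>, the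
      other those to the right.\<close>
    have mono1: "mono_on {0..h} (\<lambda>x. J x - (g x)\<^sup>2)"
    proof (rule mono_on_Icc_deriv_nonneg)
      fix x assume "x \<in> {0..h}"
      then show "((\<lambda>x. J x - (g x)\<^sup>2) has_real_derivative ((g x)\<^sup>2 + (g' x)\<^sup>2) - 2 * g x * g' x) (at x within {0..h})"
        by (intro DERIV_diff dJ dg)
      show "0 \<le> ((g x)\<^sup>2 + (g' x)\<^sup>2) - 2 * g x * g' x"
        using sum_squares_bound[of "g x" "g' x"] by simp
    qed
    have mono2: "mono_on {0..h} (\<lambda>x. J x + (g x)\<^sup>2)"
    proof (rule mono_on_Icc_deriv_nonneg)
      fix x assume "x \<in> {0..h}"
      then show "((\<lambda>x. J x + (g x)\<^sup>2) has_real_derivative ((g x)\<^sup>2 + (g' x)\<^sup>2) + 2 * g x * g' x) (at x within {0..h})"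
        by (intro DERIV_add dJ dg)
      show "0 \<le> ((g x)\<^sup>2 + (g' x)\<^sup>2) + 2 * g x * g' x"
        using sum_squares_bound[of "g x" "- g' x"] by simp
    qed
    have monoJ: "mono_on {0..h} J"
      by (rule mono_on_Icc_deriv_nonneg[OF dJ]) auto
    have J0: "J 0 = 0" by (simp add: J_def)
    have Jb: "0 \<le> J x" "J x \<le> J h" if "x \<in> {0..h}" for x
      using that J0 mono_onD[OF monoJ, of 0 x] mono_onD[OF monoJ, of x h] h_pos by auto
    have osc: "(g z)\<^sup>2 \<le> (g y)\<^sup>2 + J h" if y: "y \<in> {0..h}" for y
    proof (cases "y \<le> z")
      case True
      then show ?thesis using mono_onD[OF mono1 y z] Jb[OF y] Jb[OF z] by simp
    next
      case False
      then show ?thesis using mono_onD[OF mono2 z y] Jb[OF y] Jb[OF z] by simp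
    qed
    have ig: "(\<lambda>y. (g y)\<^sup>2) integrable_on {0..h}"
      by (intro integrable_continuous_real continuous_intros cg)
    \<comment> \<open>Integrating \<open>osc\<close> over the comparison point \<open>y\<close>
      replaces an arbitrary value of \<open>g\<close> by its mean square.\<close>
    have "integral {0..h} (\<lambda>y. (g z)\<^sup>2 - J h) \<le> integral {0..h} (\<lambda>y. (g y)\<^sup>2)"
      by (rule integral_le[OF _ ig]) (use osc in force)+
    also have "\<dots> \<le> J h"
      unfolding J_def by (rule integral_le[OF ig integrable_continuous_real[OF cJ]]) auto
    finally have "h * ((g z)\<^sup>2 - J h) \<le> J h" using h_pos by simp
    then have "(g z)\<^sup>2 \<le> (1 / h + 1) * J h" using h_pos by (simp add: field_simps)
    moreover have "m * J h \<le> energy g g' g g'"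
    proof -
      have "m * J h = integral {0..h} (\<lambda>y. m * ((g y)\<^sup>2 + (g' y)\<^sup>2))" by (simp add: J_def)
      also have "\<dots> \<le> energy g g' g g'"
        unfolding energy_def
      proof (rule integral_le[OF _ energy_integrable[OF g g]])
        show "(\<lambda>y. m * ((g y)\<^sup>2 + (g' y)\<^sup>2)) integrable_on {0..h}"
          by (intro integrable_continuous_real continuous_intros cg)
        fix y assume y: "y \<in> {0..h}"
        have "m * (g y)\<^sup>2 \<le> \<sigma> y * (g y)\<^sup>2" "m * (g' y)\<^sup>2 \<le> P y * (g' y)\<^sup>2"
          using m y by (auto intro: mult_right_mono)
        then show "m * ((g y)\<^sup>2 + (g' y)\<^sup>2) \<le> P y * g' y * g' y + \<sigma> y * g y * g y"
          by (simp add: power2_eq_square algebra_simps)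
      qed
      finally show ?thesis .
    qed
    then have "J h \<le> energy g g' g g' / m" using m(1) by (simp add: field_simps)
    then have "(1 / h + 1) * J h \<le> (1 / h + 1) * (energy g g' g g' / m)"
      using h_pos by (intro mult_left_mono) auto
    ultimately show ?thesis by (simp add: C_def)
  qed
  moreover have "0 \<le> C" using m(1) h_pos by (simp add: C_def)
  ultimately show thesis using that by blast
qed

text \<open>The Sobolev inequality for finite sums, whose energy is diagonal. The quantifiers make
  one constant serve all coefficient sequences and all finite index sets.\<close>

lemma psum_bound:
  "\<exists>C\<ge>0. \<forall>c A. finite A \<longrightarrow>
    (\<forall>z\<in>{0..h}. (psum c A z)\<^sup>2 \<le> C * (\<Sum>n\<in>A. (1 + ev n) * sqn n * (c n)\<^sup>2))"
proof -
  obtain C where "0 \<le> C" and C: "\<And>g g' z. C1_pair g g' \<Longrightarrow> z \<in> {0..h} \<Longrightarrow> (g z)\<^sup>2 \<le> C * energy g g' g g'"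
    using Sobolev by blast
  have "(psum c A z)\<^sup>2 \<le> C * (\<Sum>n\<in>A. (1 + ev n) * sqn n * (c n)\<^sup>2)"
    if "finite A" "z \<in> {0..h}" for c A z
    unfolding energy_psum_self[OF that(1), symmetric] by (rule C[OF C1_pair_psum that(2)])
  then show ?thesis using \<open>0 \<le> C\<close> by blast
qed

section \<open>Absolute and uniform convergence of series with finite energy\<close>

lemma weight_nonneg: "0 \<le> (1 + ev n) * sqn n * (c n)\<^sup>2"
  using ev_nonneg[of n] sqn_nonneg[of n] by simp

lemma psum_0: "psum c A 0 = sum c A"
  by (simp add: psum_def \<phi>_0)

text \<open>By the normalization at 0, \<open>psum c A 0\<close> is the plain sum of coefficients
  over \<open>A\<close>. It is bounded uniformly in \<open>A\<close>, so taking for \<open>A\<close>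
  the indices of nonnegative and of negative coefficients bounds the sums of absolute
  values.\<close>

lemma summable_abs_coeffs:
  assumes S: "summable (\<lambda>n. (1 + ev n) * sqn n * (c n)\<^sup>2)"
  shows "summable (\<lambda>n. \<bar>c n\<bar>)"
proof -
  from psum_bound obtain C where C: "0 \<le> C"
    "\<And>A z. finite A \<Longrightarrow> z \<in> {0..h} \<Longrightarrow> (psum c A z)\<^sup>2 \<le> C * (\<Sum>n\<in>A. (1 + ev n) * sqn n * (c n)\<^sup>2)"
    by blast
  define K where "K = sqrt (C * (\<Sum>n. (1 + ev n) * sqn n * (c n)\<^sup>2))"
  have K: "\<bar>sum c A\<bar> \<le> K" if A: "finite A" for A
  proof -
    have "(sum c A)\<^sup>2 \<le> C * (\<Sum>n\<in>A. (1 + ev n) * sqn n * (c n)\<^sup>2)"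
      using C(2)[OF A, of 0] h_pos by (simp add: psum_0)
    also have "\<dots> \<le> C * (\<Sum>n. (1 + ev n) * sqn n * (c n)\<^sup>2)"
      by (intro mult_left_mono sum_le_suminf S A C(1) weight_nonneg)
    finally show ?thesis unfolding K_def using real_le_rsqrt[of "\<bar>sum c A\<bar>"] by simp
  qed
  show ?thesis
  proof (rule summableI_nonneg_bounded)
    fix n
    let ?A = "{i\<in>{..<n}. 0 \<le> c i}" and ?B = "{i\<in>{..<n}. c i < 0}"
    have "(\<Sum>i<n. \<bar>c i\<bar>) = (\<Sum>i\<in>?A \<union> ?B. \<bar>c i\<bar>)" by (rule sum.cong) auto
    also have "\<dots> = (\<Sum>i\<in>?A. \<bar>c i\<bar>) + (\<Sum>i\<in>?B. \<bar>c i\<bar>)"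
      by (rule sum.union_disjoint) auto
    also have "(\<Sum>i\<in>?A. \<bar>c i\<bar>) = sum c ?A" by (rule sum.cong) auto
    also have "(\<Sum>i\<in>?B. \<bar>c i\<bar>) = - sum c ?B"
      unfolding sum_negf[symmetric] by (rule sum.cong) auto
    also have "sum c ?A + - sum c ?B \<le> 2 * K" using K[of ?A] K[of ?B] by simp
    finally show "(\<Sum>i<n. \<bar>c i\<bar>) \<le> 2 * K" .
  qed simp
qed

text \<open>The bound of \<open>psum_bound\<close> for the blocks \<open>{m..<n}\<close> turns the
  Cauchy criterion for the energy series into a uniform one for the partial sums.\<close>

lemma psum_uniform_limit:
  assumes S: "summable (\<lambda>n. (1 + ev n) * sqn n * (c n)\<^sup>2)"
  obtains u where "uniform_limit {0..h} (\<lambda>M. psum c {..<M}) u sequentially"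
proof -
  from psum_bound obtain C where C: "0 \<le> C"
    "\<And>A z. finite A \<Longrightarrow> z \<in> {0..h} \<Longrightarrow> (psum c A z)\<^sup>2 \<le> C * (\<Sum>n\<in>A. (1 + ev n) * sqn n * (c n)\<^sup>2)"
    by blast
  have "uniformly_Cauchy_on {0..h} (\<lambda>M. psum c {..<M})"
  proof (rule uniformly_Cauchy_onI')
    fix e :: real assume e: "e > 0"
    \<comment> \<open>The denominator \<open>C + 1\<close> covers the case \<open>C = 0\<close> and
      makes the final estimate strict.\<close>
    then have "e\<^sup>2 / (C + 1) > 0" using C(1) by simp
    then obtain N where N: "\<And>m n. N \<le> m \<Longrightarrow> norm (\<Sum>k=m..<n. (1 + ev k) * sqn k * (c k)\<^sup>2) < e\<^sup>2 / (C + 1)"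
      using S unfolding summable_Cauchy by meson
    have "dist (psum c {..<m} x) (psum c {..<n} x) < e"
      if x: "x \<in> {0..h}" and mn: "N \<le> m" "m < n" for x m n
    proof -
      have "psum c {..<n} x = psum c {..<m} x + psum c {m..<n} x"
        unfolding psum_def lessThan_atLeast0 using mn by (intro sum.atLeastLessThan_concat[symmetric]) auto
      then have d: "dist (psum c {..<m} x) (psum c {..<n} x) = \<bar>psum c {m..<n} x\<bar>"
        by (simp add: dist_real_def)
      have "(psum c {m..<n} x)\<^sup>2 \<le> C * (\<Sum>k=m..<n. (1 + ev k) * sqn k * (c k)\<^sup>2)"
        using C(2)[OF _ x] by simp
      also have "\<dots> \<le> C * (e\<^sup>2 / (C + 1))"
        using N[OF mn(1), of n] C(1) by (intro mult_left_mono) auto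
      also have "\<dots> < e\<^sup>2" using C(1) e by (simp add: field_simps)
      finally have "\<bar>psum c {m..<n} x\<bar>\<^sup>2 < e\<^sup>2" by simp
      then show ?thesis unfolding d using e by (meson less_imp_le power2_less_imp_less)
    qed
    then show "\<exists>M. \<forall>x\<in>{0..h}. \<forall>m\<ge>M. \<forall>n>m. dist (psum c {..<m} x) (psum c {..<n} x) < e"
      by blast
  qed
  then show thesis
    using that unfolding uniformly_convergent_eq_Cauchy[symmetric] uniformly_convergent_on_def by blast
qed

section \<open>Identification of the coefficients and of the limit\<close>

lemma L2_expansion_iff:
  assumes f: "continuous_on {0..h} f"
  shows "L2_expansion h \<phi> f c \<longleftrightarrow>
    (\<lambda>M. integral {0..h} (\<lambda>z. (f z - psum c {..<M} z)\<^sup>2)) \<longlonglongrightarrow> 0"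
proof -
  have "set_lebesgue_integral lebesgue {0<..<h} (\<lambda>z. (f z - (\<Sum>n<M. c n * \<phi> n z))\<^sup>2) =
    integral {0..h} (\<lambda>z. (f z - psum c {..<M} z)\<^sup>2)" for M
    unfolding psum_def[symmetric]
    by (intro set_lebesgue_integral_open_eq_integral continuous_intros f C1_pairD[OF C1_pair_psum])
  then show ?thesis unfolding L2_expansion_def by simp
qed

text \<open>The expansion converges in the unweighted norm while orthogonality holds in the weighted
  one. Cauchy-Schwarz with \<open>\<sigma> * \<phi> n\<close> as one factor bridges the two: a fixed
  defect \<open>d\<close> is bounded by an error that tends to 0.\<close>

lemma coefficient_eq:
  assumes f: "continuous_on {0..h} f" and L: "L2_expansion h \<phi> f a"
  shows "ip (\<phi> n) f = a n * sqn n"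
proof -
  define d where "d = ip (\<phi> n) f - a n * sqn n"
  define K where "K = integral {0..h} (\<lambda>z. (\<sigma> z * \<phi> n z)\<^sup>2)"
  have c1: "continuous_on {0..h} (\<lambda>z. \<sigma> z * \<phi> n z)"
    by (intro continuous_intros cont_\<sigma> C1_pairD[OF C1_pair_\<phi>])
  have "(\<lambda>M. K * integral {0..h} (\<lambda>z. (f z - psum a {..<M} z)\<^sup>2)) \<longlonglongrightarrow> K * 0"
    using L unfolding L2_expansion_iff[OF f] by (intro tendsto_intros)
  \<comment> \<open>Once \<open>M > n\<close>, the index \<open>n\<close> occurs in the partial sum,
    and its inner product with \<open>\<phi> n\<close> is exactly
    \<open>a n * sqn n\<close>.\<close>
  moreover have "\<forall>\<^sub>F M in sequentially. d\<^sup>2 \<le> K * integral {0..h} (\<lambda>z. (f z - psum a {..<M} z)\<^sup>2)"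
    using eventually_gt_at_top[of n]
  proof eventually_elim
    case (elim M)
    have c2: "continuous_on {0..h} (\<lambda>z. f z - psum a {..<M} z)"
      by (intro continuous_intros f C1_pairD[OF C1_pair_psum])
    have "((\<lambda>z. \<sigma> z * \<phi> n z * f z - \<sigma> z * \<phi> n z * psum a {..<M} z) has_integral
      ip (\<phi> n) f - ip (\<phi> n) (psum a {..<M})) {0..h}"
      unfolding ip_def
      by (intro has_integral_diff integrable_integral integrable_continuous_real
        continuous_on_mult c1 f C1_pairD[OF C1_pair_psum])
    then have "integral {0..h} (\<lambda>z. (\<sigma> z * \<phi> n z) * (f z - psum a {..<M} z)) = d"
      unfolding d_def using elim by (simp add: ip_psum right_diff_distrib integral_unique)
    then show ?case
      using Cauchy_Schwarz_integral_continuous[OF c1 c2] unfolding K_def by simp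
  qed
  ultimately have "d\<^sup>2 \<le> K * 0" by (rule tendsto_lowerbound) simp
  then show ?thesis unfolding d_def by simp
qed

text \<open>Used in two directions: to identify the uniform limit of a given expansion with
  \<open>f\<close>, and, with \<open>f\<close> equal to \<open>u\<close>, to show that a uniform
  limit has the expansion it was built from.\<close>

lemma L2_expansion_uniform:
  assumes f: "continuous_on {0..h} f" and u: "uniform_limit {0..h} (\<lambda>M. psum c {..<M}) u sequentially"
  shows "(\<lambda>M. integral {0..h} (\<lambda>z. (f z - psum c {..<M} z)\<^sup>2)) \<longlonglongrightarrow> integral {0..h} (\<lambda>z. (f z - u z)\<^sup>2)"
proof (rule tendsto_integral_uniform_limit)
  have cu: "continuous_on {0..h} u"
    by (rule uniform_limit_theorem[OF _ u]) (auto simp: C1_pairD[OF C1_pair_psum])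
  have b: "bounded ((\<lambda>z. f z - u z) ` {0..h})"
    by (intro compact_imp_bounded compact_continuous_image continuous_intros f cu) simp
  have "uniform_limit {0..h} (\<lambda>M z. f z - psum c {..<M} z) (\<lambda>z. f z - u z) sequentially"
    by (intro uniform_limit_intros u)
  from uniform_lim_mult[OF this this b b]
  show "uniform_limit {0..h} (\<lambda>M z. (f z - psum c {..<M} z)\<^sup>2) (\<lambda>z. (f z - u z)\<^sup>2) sequentially"
    by (simp add: power2_eq_square)
  show "continuous_on {0..h} (\<lambda>z. (f z - psum c {..<n} z)\<^sup>2)" for n
    by (intro continuous_intros f C1_pairD[OF C1_pair_psum])
qed

text \<open>Bessel's inequality gives finite energy, hence a uniform limit. It is also the limit in
  mean square, so it agrees with \<open>f\<close> by continuity; evaluation at 0 gives the sum of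
  the coefficients.\<close>

lemma expansion_C1:
  assumes f: "C1_pair f f'" and L: "L2_expansion h \<phi> f a"
  shows "summable (\<lambda>n. (1 + ev n) * sqn n * (a n)\<^sup>2)"
    and "uniform_limit {0..h} (\<lambda>M. psum a {..<M}) f sequentially"
    and "a sums f 0"
proof -
  note cf = C1_pairD(1)[OF f]
  show S: "summable (\<lambda>n. (1 + ev n) * sqn n * (a n)\<^sup>2)"
  proof (rule summableI_nonneg_bounded)
    fix n
    show "0 \<le> (1 + ev n) * sqn n * (a n)\<^sup>2" by (rule weight_nonneg)
    show "(\<Sum>n<n. (1 + ev n) * sqn n * (a n)\<^sup>2) \<le> energy f f' f f'"
      by (rule Bessel[OF f coefficient_eq[OF cf L]]) simp
  qed
  obtain u where u: "uniform_limit {0..h} (\<lambda>M. psum a {..<M}) u sequentially"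
    using psum_uniform_limit[OF S] .
  have cu: "continuous_on {0..h} u"
    by (rule uniform_limit_theorem[OF _ u]) (auto simp: C1_pairD[OF C1_pair_psum])
  have "integral {0..h} (\<lambda>z. (f z - u z)\<^sup>2) = 0"
    using L2_expansion_uniform[OF cf u] L unfolding L2_expansion_iff[OF cf] by (rule LIMSEQ_unique)
  moreover have "continuous_on {0..h} (\<lambda>z. (f z - u z)\<^sup>2)"
    by (intro continuous_intros cf cu)
  ultimately have "\<forall>z\<in>{0..h}. (f z - u z)\<^sup>2 = 0"
    using integral_eq_0_iff[of 0 h "\<lambda>z. (f z - u z)\<^sup>2"] h_pos by simp
  then have fu: "f z = u z" if "z \<in> {0..h}" for z using that by simp
  show *: "uniform_limit {0..h} (\<lambda>M. psum a {..<M}) f sequentially"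
    using u fu by (subst uniform_limit_cong'[of _ _ _ _ u]) auto
  from tendsto_uniform_limitI[OF *, of 0] h_pos show "a sums f 0"
    by (simp add: psum_0 sums_def)
qed

subsection \<open>The resolvent preserves monotonicity\<close>

text \<open>At a negative minimum \<open>z\<^sub>0\<close> of the flux \<open>W\<close> we have \<open>u \<le> f\<close>; to the right of \<open>z\<^sub>0\<close>
  \<open>u\<close> strictly decreases while \<open>f\<close> increases, so \<open>W\<close> would decrease further.\<close>

lemma flux_nonneg:
  assumes W: "\<And>x. x \<in> {0..h} \<Longrightarrow> (W has_real_derivative \<sigma> x * (u x - f x) / \<epsilon>) (at x within {0..h})"
    and u: "\<And>x. x \<in> {0..h} \<Longrightarrow> (u has_real_derivative W x / P x) (at x within {0..h})"
    and f: "mono_on {0..h} f" and \<epsilon>: "0 < \<epsilon>" and bd: "W 0 = 0" "W h = 0" and z: "z \<in> {0..h}"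
  shows "0 \<le> W z"
proof (rule ccontr)
  assume neg: "\<not> 0 \<le> W z"
  have cW: "continuous_on {0..h} W" using W by (rule DERIV_continuous_on)
  obtain z0 where z0: "z0 \<in> {0..h}" "\<And>y. y \<in> {0..h} \<Longrightarrow> W z0 \<le> W y"
    using continuous_attains_inf[OF compact_Icc _ cW] h_pos by (metis atLeastatMost_empty_iff2 less_imp_le not_less)
  have Wz0: "W z0 < 0" using neg z0(2)[OF z] by simp
  then have z0i: "0 < z0" "z0 < h" using z0(1) bd by (auto simp: less_le)
  \<comment> \<open>Otherwise \<open>W\<close> has positive derivative at the interior point
    \<open>z0\<close> and takes smaller values just to its left, against minimality.\<close>
  have uf: "u z0 \<le> f z0"
  proof (rule ccontr)
    assume "\<not> u z0 \<le> f z0"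
    then have "0 < \<sigma> z0 * (u z0 - f z0) / \<epsilon>" using \<sigma>_pos[OF z0(1)] \<epsilon> by simp
    then obtain d where d: "d > 0" "\<And>k. 0 < k \<Longrightarrow> z0 - k \<in> {0..h} \<Longrightarrow> k < d \<Longrightarrow> W (z0 - k) < W z0"
      using has_real_derivative_pos_inc_left[OF W[OF z0(1)]] by blast
    have "W (z0 - min z0 (d / 2)) < W z0" using d z0i by (intro d) auto
    moreover have "W z0 \<le> W (z0 - min z0 (d / 2))" using d(1) z0i by (intro z0) auto
    ultimately show False by simp
  qed
  obtain d where d: "d > 0" "\<And>y. y \<in> {0..h} \<Longrightarrow> dist y z0 < d \<Longrightarrow> dist (W y) (W z0) < - W z0"
    using cW z0(1) Wz0 unfolding continuous_on_iff by (metis neg_0_less_iff_less)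
  have Wneg: "W y < 0" if "y \<in> {0..h}" "dist y z0 < d" for y
    using d(2)[OF that] by (simp add: dist_real_def)
  \<comment> \<open>Close enough to \<open>z0\<close> for \<open>W\<close> to remain negative, so
    that \<open>u\<close> stays below \<open>u z0\<close> up to \<open>z1\<close>.\<close>
  define z1 where "z1 = min h (z0 + d / 2)"
  have z1: "z0 < z1" "z1 \<le> h" "z1 - z0 < d" using z0i d(1) by (auto simp: z1_def)
  have dec: "u y < u z0" if y: "z0 < y" "y \<le> z1" for y
  proof -
    obtain x where x: "z0 < x" "x < y" "u y - u z0 = W x / P x * (y - z0)"
      using mvt_within_Icc[OF u, where x = z0 and y = y] z0i z1 y by auto
    have xI: "x \<in> {0..h}" using x z0i z1 y by simp
    have "W x < 0" using xI x y z1 by (intro Wneg) (auto simp: dist_real_def)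
    then have "W x / P x * (y - z0) < 0"
      using P_pos[OF xI] y by (simp add: mult_neg_pos divide_neg_pos)
    then show ?thesis using x by simp
  qed
  obtain x where x: "z0 < x" "x < z1" "W z1 - W z0 = \<sigma> x * (u x - f x) / \<epsilon> * (z1 - z0)"
    using mvt_within_Icc[OF W, where x = z0 and y = z1] z0i z1 by auto
  have xI: "x \<in> {0..h}" using x z0i z1 by simp
  have "u x < u z0" using dec x by simp
  moreover have "f z0 \<le> f x" using mono_onD[OF f z0(1) xI] x by simp
  ultimately have "u x - f x < 0" using uf by simp
  then have "\<sigma> x * (u x - f x) / \<epsilon> * (z1 - z0) < 0"
    using \<sigma>_pos[OF xI] \<epsilon> z1 by (simp add: mult_neg_pos divide_neg_pos mult_pos_neg)
  moreover have "W z0 \<le> W z1" using z1 z0i by (intro z0) auto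
  ultimately show False using x by simp
qed

text \<open>The solution is built from its series: as
  \<open>c n - b n = - \<epsilon> * ev n * c n\<close>, the flux derivative of a partial sum is
  \<open>\<sigma> / \<epsilon>\<close> times the difference of the partial sums for \<open>c\<close>
  and \<open>b\<close>. This converges uniformly, and two integrations recover the flux and the
  solution, to which \<open>flux_nonneg\<close> applies.\<close>

lemma resolvent_step:
  assumes f: "C1_pair f f'" "mono_on {0..h} f" "L2_expansion h \<phi> f b" and \<epsilon>: "0 < \<epsilon>"
  obtains u u' where "C1_pair u u'" "mono_on {0..h} u"
    "L2_expansion h \<phi> u (\<lambda>n. b n / (1 + \<epsilon> * ev n))" "f 0 \<le> u 0"
proof -
  note eb = expansion_C1[OF f(1,3)] and cf = C1_pairD(1)[OF f(1)]
  define c where "c n = b n / (1 + \<epsilon> * ev n)" for n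
  have pos: "1 + \<epsilon> * ev n \<ge> 1" for n using \<epsilon> ev_nonneg[of n] by simp
  have bc: "b n = c n * (1 + \<epsilon> * ev n)" for n using pos[of n] by (simp add: c_def)
  have cb: "\<bar>c n\<bar> \<le> \<bar>b n\<bar>" for n
    unfolding bc[of n] abs_mult using pos[of n] by (simp add: mult_le_cancel_left1)
  have S: "summable (\<lambda>n. (1 + ev n) * sqn n * (c n)\<^sup>2)"
  proof (rule summable_comparison_test'[OF eb(1), of 0])
    fix n
    have "(c n)\<^sup>2 \<le> (b n)\<^sup>2" using cb[of n] by (simp add: abs_le_square_iff)
    then show "norm ((1 + ev n) * sqn n * (c n)\<^sup>2) \<le> (1 + ev n) * sqn n * (b n)\<^sup>2"
      using ev_nonneg[of n] sqn_nonneg[of n] by (auto intro!: mult_left_mono)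
  qed
  obtain v where v: "uniform_limit {0..h} (\<lambda>M. psum c {..<M}) v sequentially"
    using psum_uniform_limit[OF S] .
  have cv: "continuous_on {0..h} v"
    by (rule uniform_limit_theorem[OF _ v]) (auto simp: C1_pairD[OF C1_pair_psum])
  have bdd: "bounded (g ` {0..h})" if "continuous_on {0..h} g" for g :: "real \<Rightarrow> real"
    using that by (intro compact_imp_bounded compact_continuous_image) auto
  have c\<sigma>: "continuous_on {0..h} (\<lambda>z. \<sigma> z / \<epsilon>)" using \<epsilon> by (intro continuous_intros cont_\<sigma>) auto
  have cP: "continuous_on {0..h} (\<lambda>z. inverse (P z))"
    using P_pos by (intro continuous_intros cont_P) force
  have dW: "((\<lambda>z. P z * dpsum c {..<M} z) has_real_derivative
      \<sigma> z / \<epsilon> * (psum c {..<M} z - psum b {..<M} z)) (at z within {0..h})"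
    if "z \<in> {0..h}" for M z
  proof -
    have 1: "((\<lambda>z. \<Sum>n<M. c n * (P z * q n z)) has_real_derivative
       (\<Sum>n<M. c n * (- ev n * (\<sigma> z * \<phi> n z)))) (at z within {0..h})"
      by (intro DERIV_sum DERIV_cmult deriv_flux that)
    have 2: "(\<lambda>z. \<Sum>n<M. c n * (P z * q n z)) = (\<lambda>z. P z * dpsum c {..<M} z)"
      by (simp add: dpsum_def sum_distrib_left mult.left_commute)
    have 3: "(\<Sum>n<M. c n * (- ev n * (\<sigma> z * \<phi> n z))) =
        \<sigma> z / \<epsilon> * (psum c {..<M} z - psum b {..<M} z)"
      unfolding psum_def sum_subtractf[symmetric] sum_distrib_left bc
      using \<epsilon> by (intro sum.cong) (auto simp: field_simps)
    show ?thesis using 1 unfolding 2 3 .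
  qed
  have uW: "uniform_limit {0..h} (\<lambda>M z. \<sigma> z / \<epsilon> * (psum c {..<M} z - psum b {..<M} z))
      (\<lambda>z. \<sigma> z / \<epsilon> * (v z - f z)) sequentially"
    by (intro uniform_lim_mult uniform_limit_const uniform_limit_minus v eb(2) bdd c\<sigma>
      continuous_intros cv cf)
  \<comment> \<open>Each partial flux vanishes at 0, which supplies the initial value for the
    integration; the same at \<open>h\<close> gives \<open>Wh\<close> below.\<close>
  have W0: "(\<lambda>M. P 0 * dpsum c {..<M} 0) \<longlonglongrightarrow> 0" by (simp add: dpsum_def q_0)
  obtain W where W:
    "uniform_limit {0..h} (\<lambda>M z. P z * dpsum c {..<M} z) W sequentially" "W 0 = 0"
    "\<And>x. x \<in> {0..h} \<Longrightarrow> (W has_real_derivative \<sigma> x / \<epsilon> * (v x - f x)) (at x within {0..h})"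
    using uniform_limit_antiderivative[OF h_pos dW uW W0] by blast
  have cW: "continuous_on {0..h} W" using W(3) by (rule DERIV_continuous_on)
  have Wh: "W h = 0"
  proof (rule LIMSEQ_unique)
    show "(\<lambda>M. P h * dpsum c {..<M} h) \<longlonglongrightarrow> W h"
      using tendsto_uniform_limitI[OF W(1), of h] h_pos by simp
  qed (simp add: dpsum_def q_h)
  have "uniform_limit {0..h} (\<lambda>M z. inverse (P z) * (P z * dpsum c {..<M} z))
      (\<lambda>z. inverse (P z) * W z) sequentially"
    by (intro uniform_lim_mult uniform_limit_const W(1) bdd cP cW)
  moreover have eq1: "inverse (P z) * (P z * dpsum c {..<M} z) = dpsum c {..<M} z" if "z \<in> {0..h}" for M z
    using P_pos[OF that] by simp
  ultimately have uu: "uniform_limit {0..h} (\<lambda>M. dpsum c {..<M}) (\<lambda>z. W z / P z) sequentially"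
    by (subst (asm) uniform_limit_cong'[OF eq1 refl]) (auto simp: divide_inverse mult.commute)
  have u0: "(\<lambda>M. psum c {..<M} 0) \<longlonglongrightarrow> v 0"
    using tendsto_uniform_limitI[OF v, of 0] h_pos by simp
  \<comment> \<open>The function \<open>u\<close> is the limit \<open>v\<close> on the interval, now
    equipped with its derivative.\<close>
  obtain u where u: "uniform_limit {0..h} (\<lambda>M. psum c {..<M}) u sequentially"
    "\<And>x. x \<in> {0..h} \<Longrightarrow> (u has_real_derivative W x / P x) (at x within {0..h})"
    using uniform_limit_antiderivative[OF h_pos C1_pairD(3)[OF C1_pair_psum] uu u0] by blast
  have uv: "u x = v x" if "x \<in> {0..h}" for x
    using tendsto_uniform_limitI[OF u(1) that] tendsto_uniform_limitI[OF v that] by (rule LIMSEQ_unique)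
  have W': "(W has_real_derivative \<sigma> x * (u x - f x) / \<epsilon>) (at x within {0..h})" if "x \<in> {0..h}" for x
    using W(3)[OF that] uv[OF that] by simp
  have W_nonneg: "0 \<le> W x" if "x \<in> {0..h}" for x
    by (rule flux_nonneg[OF W' u(2) f(2) \<epsilon> W(2) Wh that])
  have C1u: "C1_pair u (\<lambda>z. W z / P z)"
    unfolding C1_pair_def using u(2) P_pos by (force intro!: continuous_intros cW cont_P)
  have mono: "mono_on {0..h} u"
    by (rule mono_on_Icc_deriv_nonneg[OF u(2)])
      (auto intro!: divide_nonneg_pos W_nonneg P_pos)
  have cu: "continuous_on {0..h} u" using C1_pairD(1)[OF C1u] .
  have L: "L2_expansion h \<phi> u c"
    using L2_expansion_uniform[OF cu u(1)] unfolding L2_expansion_iff[OF cu] by simp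
  \<comment> \<open>Otherwise \<open>W\<close> would have negative derivative at 0, where it
    vanishes, and would become negative just to the right.\<close>
  have "f 0 \<le> u 0"
  proof (rule ccontr)
    have 0: "0 \<in> {0..h}" using h_pos by simp
    assume "\<not> f 0 \<le> u 0"
    then have "\<sigma> 0 * (u 0 - f 0) / \<epsilon> < 0" using \<sigma>_pos[OF 0] \<epsilon> by (simp add: divide_neg_pos mult_pos_neg)
    then obtain d where d: "d > 0" "\<And>k. 0 < k \<Longrightarrow> 0 + k \<in> {0..h} \<Longrightarrow> k < d \<Longrightarrow> W (0 + k) < W 0"
      using has_real_derivative_neg_dec_right[OF W'[OF 0]] by blast
    have "W (0 + min h (d / 2)) < W 0" using d(1) h_pos by (intro d) auto
    moreover have "0 \<le> W (0 + min h (d / 2))" using d(1) h_pos by (intro W_nonneg) auto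
    ultimately show False using W(2) by simp
  qed
  then show thesis using that[OF C1u mono L[unfolded c_def[abs_def]]] by simp
qed

section \<open>Iterated Euler steps and passage to the exponential\<close>

lemma resolvent_iterate:
  assumes f: "C1_pair f f'" "mono_on {0..h} f" "L2_expansion h \<phi> f b" and \<epsilon>: "0 < \<epsilon>"
  shows "\<exists>u u'. C1_pair u u' \<and> mono_on {0..h} u \<and> L2_expansion h \<phi> u (\<lambda>n. b n / (1 + \<epsilon> * ev n) ^ m)"
proof (induction m)
  case 0
  then show ?case using f by auto
next
  case (Suc m)
  then obtain u u' where "C1_pair u u'" "mono_on {0..h} u"
    "L2_expansion h \<phi> u (\<lambda>n. b n / (1 + \<epsilon> * ev n) ^ m)" by blast
  from resolvent_step[OF this \<epsilon>] show ?case by (simp add: mult.commute) blast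
qed

text \<open>Each sum is the value at 0 of an Euler iterate, by \<open>expansion_C1\<close>, and one
  further step does not lower that value.\<close>

lemma incseq_resolvent_sums:
  assumes f: "C1_pair f f'" "mono_on {0..h} f" "L2_expansion h \<phi> f b" and \<epsilon>: "0 < \<epsilon>"
  shows "incseq (\<lambda>m. \<Sum>n. b n / (1 + \<epsilon> * ev n) ^ m)"
proof (rule incseq_SucI)
  fix m
  obtain u u' where u: "C1_pair u u'" "mono_on {0..h} u"
    "L2_expansion h \<phi> u (\<lambda>n. b n / (1 + \<epsilon> * ev n) ^ m)"
    using resolvent_iterate[OF f \<epsilon>] by blast
  obtain v v' where v: "C1_pair v v'"
    "L2_expansion h \<phi> v (\<lambda>n. b n / (1 + \<epsilon> * ev n) ^ m / (1 + \<epsilon> * ev n))" "u 0 \<le> v 0"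
    using resolvent_step[OF u \<epsilon>] .
  show "(\<Sum>n. b n / (1 + \<epsilon> * ev n) ^ m) \<le> (\<Sum>n. b n / (1 + \<epsilon> * ev n) ^ Suc m)"
    using v(3) sums_unique[OF expansion_C1(3)[OF u(1,3)]] sums_unique[OF expansion_C1(3)[OF v(1,2)]]
    by (simp add: mult.commute)
qed

text \<open>Tannery's theorem, with the summable majorant \<open>\<bar>b n\<bar>\<close>, carries
  the monotonicity of the Euler sums to the limit of vanishing step size.\<close>

lemma exponential_sums_mono:
  assumes f: "C1_pair f f'" "mono_on {0..h} f" "L2_expansion h \<phi> f b" and \<tau>: "0 \<le> \<tau>1" "\<tau>1 \<le> \<tau>2"
  shows "(\<Sum>n. b n * exp (- ev n * \<tau>1)) \<le> (\<Sum>n. b n * exp (- ev n * \<tau>2))"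
proof -
  define T where "T \<tau> j = (\<Sum>n. b n / (1 + 1 / real (Suc j) * ev n) ^ nat \<lfloor>real (Suc j) * \<tau>\<rfloor>)" for \<tau> j
  have lim: "T \<tau> \<longlonglongrightarrow> (\<Sum>n. b n * exp (- ev n * \<tau>))" if "0 \<le> \<tau>" for \<tau>
  proof -
    have "(\<lambda>j. b n * (1 / (1 + 1 / real (Suc j) * ev n) ^ nat \<lfloor>real (Suc j) * \<tau>\<rfloor>)) \<longlonglongrightarrow> b n * exp (- ev n * \<tau>)" for n
      by (intro tendsto_mult_left tendsto_inverse_power_floor_exp ev_nonneg that)
    then have 1: "(\<lambda>j. b n / (1 + 1 / real (Suc j) * ev n) ^ nat \<lfloor>real (Suc j) * \<tau>\<rfloor>) \<longlonglongrightarrow> b n * exp (- ev n * \<tau>)" for n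
      by simp
    have 2: "norm (b n / (1 + 1 / real (Suc j) * ev n) ^ nat \<lfloor>real (Suc j) * \<tau>\<rfloor>) \<le> \<bar>b n\<bar>" for n j
    proof -
      have "1 \<le> (1 + 1 / real (Suc j) * ev n) ^ nat \<lfloor>real (Suc j) * \<tau>\<rfloor>"
        using ev_nonneg[of n] by (intro one_le_power) simp
      then show ?thesis by (simp add: abs_divide divide_le_eq mult_le_cancel_left1)
    qed
    have 3: "summable (\<lambda>n. \<bar>b n\<bar>)" by (rule summable_abs_coeffs[OF expansion_C1(1)[OF f(1,3)]])
    show ?thesis unfolding T_def[abs_def]
      using tannerys_theorem[OF 1 always_eventually 3] 2 by auto
  qed
  \<comment> \<open>For fixed \<open>j\<close> both times use the same step size; only the number of
    steps differs.\<close>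
  have "T \<tau>1 j \<le> T \<tau>2 j" for j
    unfolding T_def
    by (rule incseqD[OF incseq_resolvent_sums[OF f]])
      (use \<tau> in \<open>auto intro!: nat_mono floor_mono mult_left_mono\<close>)
  then show ?thesis using \<tau> by (intro LIMSEQ_le[OF lim lim]) auto
qed

end

subsection \<open>Sturm--Liouville eigenfunctions\<close>

lemma D_on_eq:
  assumes "0 < h" "z \<in> {0..h}" "(f has_real_derivative d) (at z within {0..h})"
  shows "D_on h f z = d"
  using vector_derivative_within_cbox[of 0 h z f d] assms
  by (simp add: D_on_def has_real_derivative_iff_has_vector_derivative)

text \<open>Restates the eigenvalue equation with an explicit derivative \<open>q\<close> and honest
  derivatives within the interval in place of the operator \<open>D_on\<close>.\<close>

lemma eigenfunction_flux:
  assumes h: "0 < h" and k: "C2_on {0..h} k" and p: "SL_eigenfunction k w h \<mu> p"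
  shows "\<exists>q. (\<forall>z\<in>{0..h}. (p has_real_derivative q z) (at z within {0..h})) \<and>
    continuous_on {0..h} q \<and>
    (\<forall>z\<in>{0..h}. ((\<lambda>z. k z * q z) has_real_derivative - w z * q z - \<mu> * p z) (at z within {0..h})) \<and>
    q 0 = 0 \<and> q h = 0"
proof -
  obtain k' where k': "\<And>z. z \<in> {0..h} \<Longrightarrow> (k has_real_derivative k' z) (at z within {0..h})"
    using k unfolding C2_on_def by blast
  obtain q q' where q: "\<And>z. z \<in> {0..h} \<Longrightarrow> (p has_real_derivative q z) (at z within {0..h})"
    and q': "\<And>z. z \<in> {0..h} \<Longrightarrow> (q has_real_derivative q' z) (at z within {0..h})"
    using p unfolding SL_eigenfunction_def C2_on_def C1_on_def by blast
  have D: "D_on h p z = q z" if "z \<in> {0..h}" for z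
    by (rule D_on_eq[OF h that q[OF that]])
  have "((\<lambda>z. k z * q z) has_real_derivative - w z * q z - \<mu> * p z) (at z within {0..h})"
    if z: "z \<in> {0..h}" for z
  proof -
    define d where "d = k' z * q z + q' z * k z"
    have 1: "((\<lambda>z. k z * q z) has_real_derivative d) (at z within {0..h})"
      unfolding d_def by (rule DERIV_mult[OF k'[OF z] q'[OF z]])
    \<comment> \<open>\<open>Lstar\<close> differentiates \<open>k * D_on h p\<close>, known to
      equal \<open>k * q\<close> on the interval only; that suffices for a derivative within
      it.\<close>
    have "((\<lambda>z. k z * D_on h p z) has_real_derivative d) (at z within {0..h})"
      by (rule has_field_derivative_transform_within[OF 1 zero_less_one z]) (simp add: D)
    then have "D_on h (\<lambda>y. k y * D_on h p y) z = d" by (rule D_on_eq[OF h z])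
    moreover have "Lstar k w h p z + \<mu> * p z = 0"
      using p z unfolding SL_eigenfunction_def by blast
    ultimately have "d = - w z * q z - \<mu> * p z"
      unfolding Lstar_def D[OF z] by simp
    then show ?thesis using 1 by simp
  qed
  moreover have "q 0 = 0" "q h = 0"
    using p D[of 0] D[of h] h unfolding SL_eigenfunction_def by auto
  moreover have "continuous_on {0..h} q" using q' by (rule DERIV_continuous_on)
  ultimately show ?thesis using q by blast
qed

text \<open>The weight \<open>\<sigma>\<close> is an integrating factor: its derivative
  \<open>\<sigma> * w / k\<close> cancels the drift term \<open>- w * q n\<close> in the flux
  equation once that is multiplied by \<open>\<sigma>\<close>.\<close>

lemma sl_system_of_eigenfunctions:
  assumes h: "0 < h" and k: "C2_on {0..h} k" and w: "C2_on {0..h} w"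
    and k_pos: "\<forall>z\<in>{0..h}. 0 < k z"
    and ev: "strict_mono ev" "ev 0 = 0"
    and eig: "\<forall>n. SL_eigenfunction k w h (ev n) (\<phi> n)" and \<phi>0: "\<forall>n. \<phi> n 0 = 1"
  obtains \<sigma> P q where "sl_system h \<sigma> P ev \<phi> q"
proof -
  have "\<forall>n. \<exists>q. (\<forall>z\<in>{0..h}. (\<phi> n has_real_derivative q z) (at z within {0..h})) \<and>
      continuous_on {0..h} q \<and> (\<forall>z\<in>{0..h}.
       ((\<lambda>z. k z * q z) has_real_derivative - w z * q z - ev n * \<phi> n z) (at z within {0..h})) \<and>
      q 0 = 0 \<and> q h = 0" (is "\<forall>n. \<exists>q. ?Q n q")
    using eigenfunction_flux[OF h k] eig by simp
  from choice[OF this] obtain q where "\<forall>n. ?Q n (q n)" by blast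
  then have q: "\<And>n z. z \<in> {0..h} \<Longrightarrow> (\<phi> n has_real_derivative q n z) (at z within {0..h})"
    "\<And>n. continuous_on {0..h} (q n)"
    "\<And>n z. z \<in> {0..h} \<Longrightarrow>
       ((\<lambda>z. k z * q n z) has_real_derivative - w z * q n z - ev n * \<phi> n z) (at z within {0..h})"
    "\<And>n. q n 0 = 0" "\<And>n. q n h = 0"
    by blast+
  have ck: "continuous_on {0..h} k" and cw: "continuous_on {0..h} w"
    using k w unfolding C2_on_def by (auto intro: DERIV_continuous_on)
  define \<sigma> where "\<sigma> z = exp (integral {0..z} (\<lambda>x. w x / k x))" for z
  have cwk: "continuous_on {0..h} (\<lambda>x. w x / k x)"
    using k_pos by (intro continuous_intros ck cw) force
  have d\<sigma>: "(\<sigma> has_real_derivative \<sigma> z * (w z / k z)) (at z within {0..h})" if "z \<in> {0..h}" for z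
    unfolding \<sigma>_def[abs_def]
    by (rule DERIV_chain2[OF DERIV_exp integral_has_real_derivative[OF cwk that]])
  have c\<sigma>: "continuous_on {0..h} \<sigma>" using d\<sigma> by (rule DERIV_continuous_on)
  have "sl_system h \<sigma> (\<lambda>z. \<sigma> z * k z) ev \<phi> q"
  proof
    show "continuous_on {0..h} (\<lambda>z. \<sigma> z * k z)" by (intro continuous_intros c\<sigma> ck)
    show "0 < \<sigma> z" for z by (simp add: \<sigma>_def)
    show "0 < \<sigma> z * k z" if "z \<in> {0..h}" for z using k_pos that by (simp add: \<sigma>_def)
    show "((\<lambda>z. \<sigma> z * k z * q n z) has_real_derivative - ev n * (\<sigma> z * \<phi> n z)) (at z within {0..h})"
      if z: "z \<in> {0..h}" for n z
    proof -
      have "k z \<noteq> 0" using k_pos z by force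
      then show ?thesis using DERIV_mult[OF d\<sigma>[OF z] q(3)[OF z, of n]]
        by (simp add: algebra_simps)
    qed
    show "0 \<le> ev n" for n using ev strict_mono_less_eq[of ev 0 n] by simp
    show "inj ev" using ev(1) by (rule strict_mono_imp_inj_on)
  qed (use h c\<sigma> q \<phi>0 in auto)
  then show thesis using that by blast
qed

section \<open>The functions \<open>G_fun\<close>\<close>

lemma L2_expansion_minus:
  assumes "L2_expansion h \<phi> f a"
  shows "L2_expansion h \<phi> (\<lambda>z. - f z) (\<lambda>n. - a n)"
proof -
  have "(- f z - (\<Sum>n<m. - a n * \<phi> n z))\<^sup>2 = (f z - (\<Sum>n<m. a n * \<phi> n z))\<^sup>2" for z m
    using power2_minus[of "f z - (\<Sum>n<m. a n * \<phi> n z)"] by (simp add: sum_negf)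
  then show ?thesis using assms unfolding L2_expansion_def by simp
qed

text \<open>Continuity of \<open>F\<close> is available on \<open>{0..T}\<close> only, as the series
  may diverge beyond \<open>T\<close>. Moving the indicator into the domain of integration confines
  everything to that interval.\<close>

lemma L2_on_indicator_continuous:
  assumes F: "continuous_on {0..T} F"
  shows "L2_on b (\<lambda>s. F s * indicator {0..T} s)"
proof -
  let ?S = "{0<..<b} \<inter> {0..T}"
  have *: "set_integrable lebesgue ?S f" if "continuous_on {0..T} f" for f :: "real \<Rightarrow> real"
    by (rule set_integrable_subset[OF absolutely_integrable_continuous_real[OF that]]) auto
  have 1: "(\<lambda>x. indicator {0<..<b} x *\<^sub>R (F x * indicator {0..T} x)) = (\<lambda>x. indicator ?S x *\<^sub>R F x)"
    by (auto simp: indicator_def)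
  have 2: "(\<lambda>x. indicator {0<..<b} x *\<^sub>R (F x * indicator {0..T} x)\<^sup>2) = (\<lambda>x. indicator ?S x *\<^sub>R (F x)\<^sup>2)"
    by (auto simp: indicator_def)
  show ?thesis
    unfolding L2_on_def set_borel_measurable_def set_integrable_def 1 2
    using *[OF F] *[OF continuous_on_power[OF F]]
    unfolding set_integrable_def by (auto dest: borel_measurable_integrable)
qed

text \<open>The summability clause ensures that the infinite sum in \<open>G_fun\<close> is genuine
  on \<open>{0..t i}\<close>. The increasing case is stated on \<open>{0..t i}\<close>, since the
  cut-off to 0 after \<open>t i\<close> can be a drop; in the decreasing case that drop fits, and
  the claim covers \<open>{0..t N}\<close>.\<close>

theorem theorem2:
  fixes h :: real and k w \<rho> :: "real \<Rightarrow> real"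
    and N :: nat and t r :: "nat \<Rightarrow> real"
    and ev a :: "nat \<Rightarrow> real" and \<phi> :: "nat \<Rightarrow> real \<Rightarrow> real"
  assumes "h > 0"
    and "C2_on {0..h} k" and "C2_on {0..h} w"
    and "\<forall>z\<in>{0..h}. k z > 0"
    and "w 0 = 0" and "w h = 0"
    and "1 \<le> N" and "0 < t 1" and "strict_mono_on {1..N} t"
    and "\<forall>i\<in>{1..N}. r i > 0"
    and "strict_mono ev" and "ev 0 = 0"
    and "range ev = {\<mu>. SL_eigenvalue k w h \<mu>}"
    and "\<forall>n. SL_simple k w h (ev n)"
    and "\<forall>n. SL_eigenfunction k w h (ev n) (\<phi> n)"
    and "\<forall>n. \<phi> n 0 = 1"
    and "L2_basis h \<phi>"
    and "C1_on {0..h} \<rho>" and "\<forall>z\<in>{0..h}. \<rho> z \<ge> 0"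
    and "L2_expansion h \<phi> \<rho> a"
  shows "\<forall>i\<in>{1..N}.
      (\<forall>s\<in>{0..t i}. summable (\<lambda>n. a n * exp (ev n * (s - t i)))) \<and>
      L2_on (t N) (G_fun (k 0) (r i) (t i) a ev) \<and>
      (mono_on {0..h} \<rho> \<longrightarrow> antimono_on {0..t N} (G_fun (k 0) (r i) (t i) a ev)) \<and>
      (antimono_on {0..h} \<rho> \<longrightarrow> mono_on {0..t i} (G_fun (k 0) (r i) (t i) a ev))"
proof
  fix i assume i: "i \<in> {1..N}"
  obtain \<sigma> P q where "sl_system h \<sigma> P ev \<phi> q"
    using sl_system_of_eigenfunctions[of h k w ev \<phi>] assms by blast
  then interpret sl_system h \<sigma> P ev \<phi> q .
  obtain \<rho>' where \<rho>: "C1_pair \<rho> \<rho>'"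
    using \<open>C1_on {0..h} \<rho>\<close> unfolding C1_on_def C1_pair_def by blast
  note L = \<open>L2_expansion h \<phi> \<rho> a\<close>
  have abs: "summable (\<lambda>n. \<bar>a n\<bar>)"
    by (rule summable_abs_coeffs[OF expansion_C1(1)[OF \<rho> L]])
  define T where "T = t i"
  define F where "F s = (\<Sum>n. a n * exp (ev n * (s - T)))" for s
  define K where "K = k 0 * inverse (r i)"
  have K: "0 \<le> K" unfolding K_def using assms(1,4,10) i by (auto intro!: mult_nonneg_nonneg less_imp_le)
  have G: "G_fun (k 0) (r i) (t i) a ev = (\<lambda>s. K * F s * indicator {0..T} s)"
    by (simp add: G_fun_def K_def F_def T_def fun_eq_iff)
  have term_le: "norm (a n * exp (ev n * (s - T))) \<le> \<bar>a n\<bar>" if "s \<in> {0..T}" for n s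
    using that ev_nonneg[of n] by (simp add: abs_mult mult_left_le mult_nonneg_nonpos)
  have summ: "summable (\<lambda>n. a n * exp (ev n * (s - T)))" if "s \<in> {0..T}" for s
    by (rule summable_comparison_test'[OF abs, of 0]) (rule term_le[OF that])
  have "uniform_limit {0..T} (\<lambda>m s. \<Sum>n<m. a n * exp (ev n * (s - T))) F sequentially"
    unfolding F_def[abs_def] by (rule Weierstrass_m_test[OF term_le abs])
  then have "continuous_on {0..T} F"
    by (rule uniform_limit_theorem[rotated]) (auto intro!: always_eventually continuous_intros)
  then have L2: "L2_on (t N) (\<lambda>s. K * F s * indicator {0..T} s)"
    by (intro L2_on_indicator_continuous continuous_intros)
  have F_eq: "F s = (\<Sum>n. a n * exp (- ev n * (T - s)))" for s
    unfolding F_def by (simp add: algebra_simps)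
  \<comment> \<open>At \<open>s = T\<close> all exponentials equal 1, which leaves the sum of the
    coefficients.\<close>
  have FT: "F T = \<rho> 0"
    using sums_unique[OF expansion_C1(3)[OF \<rho> L]] by (simp add: F_def)
  have anti: "antimono_on {0..t N} (\<lambda>s. K * F s * indicator {0..T} s)" if mono: "mono_on {0..h} \<rho>"
  proof (rule monotone_onI)
    fix s1 s2 assume s: "s1 \<in> {0..t N}" "s2 \<in> {0..t N}" "s1 \<le> s2"
    have Fmono: "F y \<le> F x" if "x \<le> y" "y \<le> T" for x y
      unfolding F_eq using that by (intro exponential_sums_mono[OF \<rho> mono L]) auto
    \<comment> \<open>Nonnegativity of \<open>\<rho>\<close> at 0 enters here: \<open>F\<close>
      decreases to a nonnegative value at \<open>T\<close>, so the jump to 0 afterwards is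
      downward.\<close>
    have "0 \<le> F T" using FT assms(1,19) by simp
    then have "0 \<le> F x" if "x \<le> T" for x
      using Fmono[OF that order_refl] by simp
    then show "K * F s2 * indicator {0..T} s2 \<le> K * F s1 * indicator {0..T} s1"
      using K s Fmono[of s1 s2] by (auto simp: indicator_def intro: mult_left_mono)
  qed
  have mono: "mono_on {0..T} (\<lambda>s. K * F s * indicator {0..T} s)" if anti: "antimono_on {0..h} \<rho>"
  proof (rule mono_onI)
    fix s1 s2 assume s: "s1 \<in> {0..T}" "s2 \<in> {0..T}" "s1 \<le> s2"
    \<comment> \<open>The decreasing case is the increasing one for \<open>- \<rho>\<close> with
      coefficients \<open>- a n\<close>; the exponential comparison imposes no sign on the
      function.\<close>
    have "C1_pair (\<lambda>z. - \<rho> z) (\<lambda>z. - \<rho>' z)"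
      using \<rho> unfolding C1_pair_def by (auto intro!: continuous_intros DERIV_minus)
    moreover have "mono_on {0..h} (\<lambda>z. - \<rho> z)"
      using anti by (auto simp: monotone_on_def)
    ultimately have "(\<Sum>n. - a n * exp (- ev n * (T - s2))) \<le> (\<Sum>n. - a n * exp (- ev n * (T - s1)))"
      using s by (intro exponential_sums_mono[OF _ _ L2_expansion_minus[OF L]]) auto
    moreover have "(\<Sum>n. - a n * exp (- ev n * (T - s))) = - F s" if "s \<in> {0..T}" for s
      using suminf_minus[OF summ[OF that]] by (simp add: F_def algebra_simps)
    ultimately have "F s1 \<le> F s2" using s by simp
    then show "K * F s1 * indicator {0..T} s1 \<le> K * F s2 * indicator {0..T} s2"
      using K s by (simp add: mult_left_mono)
  qed
  show "(\<forall>s\<in>{0..t i}. summable (\<lambda>n. a n * exp (ev n * (s - t i)))) \<and>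
      L2_on (t N) (G_fun (k 0) (r i) (t i) a ev) \<and>
      (mono_on {0..h} \<rho> \<longrightarrow> antimono_on {0..t N} (G_fun (k 0) (r i) (t i) a ev)) \<and>
      (antimono_on {0..h} \<rho> \<longrightarrow> mono_on {0..t i} (G_fun (k 0) (r i) (t i) a ev))"
    unfolding G unfolding T_def[symmetric] using L2
    by (intro conjI ballI impI) (assumption | erule summ anti mono)+
qed

end
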